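(* Let $\mathcal D_H$ be a left $H$-category. Then $\mathbb U_H(\mathcal D_H)$ is a subgroup of $\mathbb G(\mathcal D_H)$.
   Context: $H$ is a Hopf algebra over $k=\mathbb C$ with comultiplication $\Delta(h)=h_1\otimes h_2$ (Sweedler notation), counit $\varepsilon$ and bijective antipode $S$. A left $H$-category is a small $k$-linear category $\mathcal D_H$ such that each $Hom_{\mathcal D_H}(X,Y)$ is a left $H$-module, $h(\mathrm{id}_X)=\varepsilon(h)\mathrm{id}_X$ for all objects $X$ and $h\in H$, and $h(gf)=(h_1g)(h_2f)$ for all composable morphisms $g,f$ and $h\in H$. $\mathbb G(\mathcal D_H):=\prod_{X\in Ob(\mathcal D_H)}Aut_{\mathcal D_H}(X)$, a group under componentwise composition; an element $\eta$ is a family of automorphisms $\{\eta(X):X\to X\}_{X\in Ob(\mathcal D_H)}$. Define $$\mathbb U_H(\mathcal D_H):=\{\eta\in\mathbb G(\mathcal D_H)\ :\ h(\eta(X))=\varepsilon(h)\eta(X)\ \text{for every } h\in H,\ X\in Ob(\mathcal D_H)\}.$$ *)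

theory Defs
  imports Complex_Main "HOL-Algebra.Algebra" "HOL-Algebra.Algebraic_Closure_Type"
begin

abbreviation complex_ring :: "complex ring" where
  "complex_ring \<equiv> ring_of_type_algebra"

text \<open>
  Complex vector spaces are modules over \<open>complex_ring\<close>. The fields \<open>mult\<close> and \<open>one\<close> of
  the module record carry no meaning for a mere vector space and are left unspecified.
\<close>

section \<open>Linear and bilinear maps\<close>

definition lin_maps ::
  "(complex, 'v, 'x) module_scheme \<Rightarrow> (complex, 'w, 'y) module_scheme \<Rightarrow> ('v \<Rightarrow> 'w) set" where
  "lin_maps V W = {f \<in> carrier V \<rightarrow> carrier W.
     (\<forall>x\<in>carrier V. \<forall>y\<in>carrier V. f (x \<oplus>\<^bsub>V\<^esub> y) = f x \<oplus>\<^bsub>W\<^esub> f y) \<and>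
     (\<forall>c. \<forall>x\<in>carrier V. f (c \<odot>\<^bsub>V\<^esub> x) = c \<odot>\<^bsub>W\<^esub> f x)}"

definition bilin_maps ::
  "(complex, 'v, 'x) module_scheme \<Rightarrow> (complex, 'w, 'y) module_scheme \<Rightarrow>
   (complex, 'p, 'z) module_scheme \<Rightarrow> ('v \<Rightarrow> 'w \<Rightarrow> 'p) set" where
  "bilin_maps V W P = {B. (\<forall>v\<in>carrier V. B v \<in> lin_maps W P) \<and>
                          (\<forall>w\<in>carrier W. (\<lambda>v. B v w) \<in> lin_maps V P)}"

section \<open>Tensor products\<close>

definition free_space :: "'s set \<Rightarrow> (complex, 's \<Rightarrow> complex) module" where
  "free_space S =
     \<lparr>carrier = {f. finite {s. f s \<noteq> 0} \<and> {s. f s \<noteq> 0} \<subseteq> S},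
      monoid.mult = undefined, one = undefined,
      ring.zero = (\<lambda>_. 0), ring.add = (\<lambda>f g s. f s + g s), module.smult = (\<lambda>c f s. c * f s)\<rparr>"

definition single :: "'s \<Rightarrow> 's \<Rightarrow> complex" where
  "single s = (\<lambda>t. if t = s then 1 else 0)"

definition lin_span :: "(complex, 'v, 'x) module_scheme \<Rightarrow> 'v set \<Rightarrow> 'v set" where
  "lin_span V S = \<Inter>{U. submodule U complex_ring V \<and> S \<subseteq> U}"

definition quotient_space ::
  "(complex, 'v, 'x) module_scheme \<Rightarrow> 'v set \<Rightarrow> (complex, 'v set) module" where
  "quotient_space V N =
     \<lparr>carrier = a_rcosets\<^bsub>V\<^esub> N, monoid.mult = undefined, one = undefined,
      ring.zero = N, ring.add = set_add V, module.smult = (\<lambda>c A. \<Union>x\<in>A. N +>\<^bsub>V\<^esub> (c \<odot>\<^bsub>V\<^esub> x))\<rparr>"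

definition tensor_rels ::
  "(complex, 'v, 'x) module_scheme \<Rightarrow> (complex, 'w, 'y) module_scheme \<Rightarrow> ('v \<times> 'w \<Rightarrow> complex) set" where
  "tensor_rels V W =
     {(\<lambda>p. single (v \<oplus>\<^bsub>V\<^esub> v', w) p - single (v, w) p - single (v', w) p) |v v' w.
        v \<in> carrier V \<and> v' \<in> carrier V \<and> w \<in> carrier W} \<union>
     {(\<lambda>p. single (v, w \<oplus>\<^bsub>W\<^esub> w') p - single (v, w) p - single (v, w') p) |v w w'.
        v \<in> carrier V \<and> w \<in> carrier W \<and> w' \<in> carrier W} \<union>
     {(\<lambda>p. single (c \<odot>\<^bsub>V\<^esub> v, w) p - c * single (v, w) p) |c v w.
        v \<in> carrier V \<and> w \<in> carrier W} \<union>
     {(\<lambda>p. single (v, c \<odot>\<^bsub>W\<^esub> w) p - c * single (v, w) p) |c v w.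
        v \<in> carrier V \<and> w \<in> carrier W}"

definition tensor_null ::
  "(complex, 'v, 'x) module_scheme \<Rightarrow> (complex, 'w, 'y) module_scheme \<Rightarrow> ('v \<times> 'w \<Rightarrow> complex) set" where
  "tensor_null V W = lin_span (free_space (carrier V \<times> carrier W)) (tensor_rels V W)"

definition tensor ::
  "(complex, 'v, 'x) module_scheme \<Rightarrow> (complex, 'w, 'y) module_scheme \<Rightarrow>
   (complex, ('v \<times> 'w \<Rightarrow> complex) set) module" where
  "tensor V W = quotient_space (free_space (carrier V \<times> carrier W)) (tensor_null V W)"

definition pure ::
  "(complex, 'v, 'x) module_scheme \<Rightarrow> (complex, 'w, 'y) module_scheme \<Rightarrow>
   'v \<Rightarrow> 'w \<Rightarrow> ('v \<times> 'w \<Rightarrow> complex) set" where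
  "pure V W v w = tensor_null V W +>\<^bsub>free_space (carrier V \<times> carrier W)\<^esub> single (v, w)"

definition free_eval ::
  "(complex, 'p, 'z) module_scheme \<Rightarrow> ('v \<Rightarrow> 'w \<Rightarrow> 'p) \<Rightarrow> ('v \<times> 'w \<Rightarrow> complex) \<Rightarrow> 'p" where
  "free_eval P B f = (\<Oplus>\<^bsub>P\<^esub>p\<in>{p. f p \<noteq> 0}. f p \<odot>\<^bsub>P\<^esub> B (fst p) (snd p))"

text \<open>
  The linear map on a tensor product that a bilinear map \<open>B\<close> induces, evaluated at \<open>t\<close>. It is
  computed on a chosen representative of the class \<open>t\<close>; the choice does not matter, see
  \<open>tensor_lift_eq\<close> below. In Sweedler notation, \<open>tensor_lift P B (\<Delta> h)\<close> is
  \<open>B h\<^sub>1 h\<^sub>2\<close>.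
\<close>

definition tensor_lift ::
  "(complex, 'p, 'z) module_scheme \<Rightarrow> ('v \<Rightarrow> 'w \<Rightarrow> 'p) \<Rightarrow> ('v \<times> 'w \<Rightarrow> complex) set \<Rightarrow> 'p" where
  "tensor_lift P B t = free_eval P B (SOME f. f \<in> t)"

lemma complex_ring_simps [simp]:
  "carrier complex_ring = UNIV" "x \<oplus>\<^bsub>complex_ring\<^esub> y = x + y"
  "x \<otimes>\<^bsub>complex_ring\<^esub> y = x * y" "\<zero>\<^bsub>complex_ring\<^esub> = 0" "\<one>\<^bsub>complex_ring\<^esub> = 1"
  by (simp_all add: ring_of_type_algebra_def)

lemma free_space_module: "module complex_ring (free_space S)"
proof (rule moduleI)
  show "cring complex_ring" by (rule cring_from_type_algebra)
  have fin: "finite {s. f s + g s \<noteq> 0}" if "finite {s. f s \<noteq> 0}" "finite {s. g s \<noteq> 0}"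
    for f g :: "'a \<Rightarrow> complex"
    using finite_UnI[OF that] by (rule rev_finite_subset) auto
  show "abelian_group (free_space S)"
  proof (rule abelian_groupI)
    fix f assume f: "f \<in> carrier (free_space S)"
    then show "\<exists>g\<in>carrier (free_space S). g \<oplus>\<^bsub>free_space S\<^esub> f = \<zero>\<^bsub>free_space S\<^esub>"
      by (intro bexI[of _ "\<lambda>s. - f s"]) (auto simp: free_space_def)
  next
    fix f g assume "f \<in> carrier (free_space S)" "g \<in> carrier (free_space S)"
    then show "f \<oplus>\<^bsub>free_space S\<^esub> g \<in> carrier (free_space S)"
      using fin[of f g] by (auto simp: free_space_def subset_iff) (metis add.right_neutral add.left_neutral)
  qed (auto simp: free_space_def algebra_simps)
  show "c \<odot>\<^bsub>free_space S\<^esub> f \<in> carrier (free_space S)" if "f \<in> carrier (free_space S)" for c f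
    using that by (auto simp: free_space_def)
qed (auto simp: free_space_def algebra_simps)

lemma free_eval_superset:
  assumes P: "module complex_ring P"
    and B: "\<And>v w. v \<in> carrier V \<Longrightarrow> w \<in> carrier W \<Longrightarrow> B v w \<in> carrier P"
    and S: "finite S" "{p. f p \<noteq> 0} \<subseteq> S" "S \<subseteq> carrier V \<times> carrier W"
  shows "free_eval P B f = (\<Oplus>\<^bsub>P\<^esub>p\<in>S. f p \<odot>\<^bsub>P\<^esub> B (fst p) (snd p))"
proof -
  interpret P: module complex_ring P by (rule P)
  have l0: "0 \<odot>\<^bsub>P\<^esub> x = \<zero>\<^bsub>P\<^esub>" if "x \<in> carrier P" for x
    using P.smult_l_null[OF that] by simp
  show ?thesis
    unfolding free_eval_def using S B P.smult_closed
    by (intro P.add.finprod_mono_neutral_cong_left) (auto intro!: l0)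
qed

lemma free_eval_closed:
  assumes P: "module complex_ring P"
    and B: "\<And>v w. v \<in> carrier V \<Longrightarrow> w \<in> carrier W \<Longrightarrow> B v w \<in> carrier P"
    and f: "f \<in> carrier (free_space (carrier V \<times> carrier W))"
  shows "free_eval P B f \<in> carrier P"
proof -
  interpret P: module complex_ring P by (rule P)
  show ?thesis
    unfolding free_eval_def using f B P.smult_closed
    by (intro P.finsum_closed) (auto simp: free_space_def)
qed

lemma free_eval_add:
  assumes P: "module complex_ring P"
    and B: "\<And>v w. v \<in> carrier V \<Longrightarrow> w \<in> carrier W \<Longrightarrow> B v w \<in> carrier P"
    and f: "f \<in> carrier (free_space (carrier V \<times> carrier W))"
    and g: "g \<in> carrier (free_space (carrier V \<times> carrier W))"
  shows "free_eval P B (\<lambda>p. f p + g p) = free_eval P B f \<oplus>\<^bsub>P\<^esub> free_eval P B g"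
proof -
  interpret P: module complex_ring P by (rule P)
  define S where "S = {p. f p \<noteq> 0} \<union> {p. g p \<noteq> 0}"
  have S: "finite S" "S \<subseteq> carrier V \<times> carrier W"
    using f g by (auto simp: S_def free_space_def)
  have c: "B (fst p) (snd p) \<in> carrier P" if "p \<in> S" for p
    using that S B by auto
  have "free_eval P B h = (\<Oplus>\<^bsub>P\<^esub>p\<in>S. h p \<odot>\<^bsub>P\<^esub> B (fst p) (snd p))" if "{p. h p \<noteq> 0} \<subseteq> S" for h
    using P B S that by (intro free_eval_superset[of P V W]) auto
  moreover have "{p. f p + g p \<noteq> 0} \<subseteq> S" "{p. f p \<noteq> 0} \<subseteq> S" "{p. g p \<noteq> 0} \<subseteq> S"
    by (auto simp: S_def)
  moreover have "(\<Oplus>\<^bsub>P\<^esub>p\<in>S. (f p + g p) \<odot>\<^bsub>P\<^esub> B (fst p) (snd p)) =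
      (\<Oplus>\<^bsub>P\<^esub>p\<in>S. f p \<odot>\<^bsub>P\<^esub> B (fst p) (snd p) \<oplus>\<^bsub>P\<^esub> g p \<odot>\<^bsub>P\<^esub> B (fst p) (snd p))"
    using c P.smult_l_distr P.smult_closed by (intro P.finsum_cong') auto
  moreover have "\<dots> = (\<Oplus>\<^bsub>P\<^esub>p\<in>S. f p \<odot>\<^bsub>P\<^esub> B (fst p) (snd p)) \<oplus>\<^bsub>P\<^esub> (\<Oplus>\<^bsub>P\<^esub>p\<in>S. g p \<odot>\<^bsub>P\<^esub> B (fst p) (snd p))"
    using c P.smult_closed by (intro P.finsum_addf) auto
  ultimately show ?thesis by simp
qed

lemma free_eval_scale:
  assumes P: "module complex_ring P"
    and B: "\<And>v w. v \<in> carrier V \<Longrightarrow> w \<in> carrier W \<Longrightarrow> B v w \<in> carrier P"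
    and f: "f \<in> carrier (free_space (carrier V \<times> carrier W))"
  shows "free_eval P B (\<lambda>p. c * f p) = c \<odot>\<^bsub>P\<^esub> free_eval P B f"
proof -
  interpret P: module complex_ring P by (rule P)
  define S where "S = {p. f p \<noteq> 0}"
  have S: "finite S" "S \<subseteq> carrier V \<times> carrier W"
    using f by (auto simp: S_def free_space_def)
  have cl: "B (fst p) (snd p) \<in> carrier P" if "p \<in> S" for p
    using that S B by auto
  have "free_eval P B h = (\<Oplus>\<^bsub>P\<^esub>p\<in>S. h p \<odot>\<^bsub>P\<^esub> B (fst p) (snd p))" if "{p. h p \<noteq> 0} \<subseteq> S" for h
    using P B S that by (intro free_eval_superset[of P V W]) auto
  moreover have "{p. c * f p \<noteq> 0} \<subseteq> S" "{p. f p \<noteq> 0} \<subseteq> S"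
    by (auto simp: S_def)
  moreover have "(\<Oplus>\<^bsub>P\<^esub>p\<in>S. (c * f p) \<odot>\<^bsub>P\<^esub> B (fst p) (snd p)) =
      (\<Oplus>\<^bsub>P\<^esub>p\<in>S. c \<odot>\<^bsub>P\<^esub> (f p \<odot>\<^bsub>P\<^esub> B (fst p) (snd p)))"
    using cl P.smult_assoc1 P.smult_closed by (intro P.finsum_cong') auto
  moreover have "c \<odot>\<^bsub>P\<^esub> (\<Oplus>\<^bsub>P\<^esub>p\<in>S. f p \<odot>\<^bsub>P\<^esub> B (fst p) (snd p)) =
      (\<Oplus>\<^bsub>P\<^esub>p\<in>S. c \<odot>\<^bsub>P\<^esub> (f p \<odot>\<^bsub>P\<^esub> B (fst p) (snd p)))"
    using cl P.smult_closed S by (intro P.finsum_smult_ldistr) auto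
  ultimately show ?thesis by simp
qed

lemma single_in_free_space: "s \<in> S \<Longrightarrow> single s \<in> carrier (free_space S)"
  by (auto simp: single_def free_space_def)

lemma free_eval_single:
  assumes P: "module complex_ring P"
    and B: "\<And>v w. v \<in> carrier V \<Longrightarrow> w \<in> carrier W \<Longrightarrow> B v w \<in> carrier P"
    and vw: "v \<in> carrier V" "w \<in> carrier W"
  shows "free_eval P B (single (v, w)) = B v w"
proof -
  interpret P: module complex_ring P by (rule P)
  have "1 \<odot>\<^bsub>P\<^esub> B v w = B v w" using P.smult_one[of "B v w"] B vw by simp
  then show ?thesis
    using B vw by (simp add: free_eval_def single_def)
qed

lemma tensor_null_eval:
  assumes P: "module complex_ring P" and V: "module complex_ring V" and W: "module complex_ring W"
    and B: "B \<in> bilin_maps V W P" and f: "f \<in> tensor_null V W"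
  shows "f \<in> carrier (free_space (carrier V \<times> carrier W)) \<and> free_eval P B f = \<zero>\<^bsub>P\<^esub>"
proof -
  interpret P: module complex_ring P by (rule P)
  interpret V: module complex_ring V by (rule V)
  interpret W: module complex_ring W by (rule W)
  let ?F = "free_space (carrier V \<times> carrier W)"
  interpret F: module complex_ring ?F by (rule free_space_module)
  have Bc: "B v w \<in> carrier P" if "v \<in> carrier V" "w \<in> carrier W" for v w
    using B that by (auto simp: bilin_maps_def lin_maps_def)
  note ev = free_eval_add[of P V W B, OF P Bc] free_eval_scale[of P V W B, OF P Bc]
    free_eval_single[of P V W B, OF P Bc]
  note ec = free_eval_closed[of P V W B, OF P Bc]
  have Fadd: "(\<lambda>p. f p + g p) \<in> carrier ?F" if "f \<in> carrier ?F" "g \<in> carrier ?F" for f g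
    using F.a_closed[OF that] by (simp add: free_space_def)
  have Fscale: "(\<lambda>p. c * f p) \<in> carrier ?F" if "f \<in> carrier ?F" for f c
    using F.smult_closed[of c f] that by (simp add: free_space_def)
  have m1: "(-1) \<odot>\<^bsub>P\<^esub> x = \<ominus>\<^bsub>P\<^esub> x" if "x \<in> carrier P" for x
    using P.smult_l_distr[of "-1" 1 x] P.smult_one[of x] P.smult_l_null[OF that] that
      P.minus_equality[of "(-1) \<odot>\<^bsub>P\<^esub> x" x] P.smult_closed[of "-1" x] by simp
  have diff: "free_eval P B (\<lambda>p. f p - g p) = free_eval P B f \<ominus>\<^bsub>P\<^esub> free_eval P B g \<and>
      (\<lambda>p. f p - g p) \<in> carrier ?F"
    if "f \<in> carrier ?F" "g \<in> carrier ?F" for f g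
  proof -
    have g: "(\<lambda>p. -1 * g p) \<in> carrier ?F" by (rule Fscale[OF that(2)])
    have "free_eval P B (\<lambda>p. f p + -1 * g p) = free_eval P B f \<oplus>\<^bsub>P\<^esub> free_eval P B (\<lambda>p. -1 * g p)"
      using that g by (intro ev(1)) auto
    moreover have "free_eval P B (\<lambda>p. -1 * g p) = \<ominus>\<^bsub>P\<^esub> free_eval P B g"
      using that ev(2)[of g "-1"] m1[OF ec[of g]] by simp
    ultimately show ?thesis
      using Fadd[OF that(1) g] by (simp add: a_minus_def)
  qed
  let ?U = "{f \<in> carrier ?F. free_eval P B f = \<zero>\<^bsub>P\<^esub>}"
  have "submodule ?U complex_ring ?F"
  proof (rule F.submoduleI)
    show "\<zero>\<^bsub>?F\<^esub> \<in> ?U"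
      using F.zero_closed by (simp add: free_space_def free_eval_def)
    show add: "f \<oplus>\<^bsub>?F\<^esub> g \<in> ?U" if "f \<in> ?U" "g \<in> ?U" for f g
      using that ev(1)[of f g] F.a_closed[of f g] by (simp add: free_space_def)
    show sm: "c \<odot>\<^bsub>?F\<^esub> f \<in> ?U" if "f \<in> ?U" for c f
      using that ev(2)[of f c] F.smult_closed[of c f] P.smult_r_null[of c]
      by (simp add: free_space_def)
    show "\<ominus>\<^bsub>?F\<^esub> f \<in> ?U" if "f \<in> ?U" for f
    proof -
      have "f \<in> carrier ?F" using that by simp
      moreover have "(-1) \<odot>\<^bsub>?F\<^esub> f \<oplus>\<^bsub>?F\<^esub> f = \<zero>\<^bsub>?F\<^esub>" by (simp add: free_space_def)
      ultimately have "\<ominus>\<^bsub>?F\<^esub> f = (-1) \<odot>\<^bsub>?F\<^esub> f"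
        using F.minus_equality[of "(-1) \<odot>\<^bsub>?F\<^esub> f" f] F.smult_closed[of "-1" f] by simp
      then show ?thesis using sm[OF that, of "-1"] by simp
    qed
  qed auto
  moreover have "tensor_rels V W \<subseteq> ?U"
  proof -
    have s: "single (v, w) \<in> carrier ?F" if "v \<in> carrier V" "w \<in> carrier W" for v w
      using that by (auto intro: single_in_free_space)
    have 0: "(x \<oplus>\<^bsub>P\<^esub> y) \<ominus>\<^bsub>P\<^esub> x \<ominus>\<^bsub>P\<^esub> y = \<zero>\<^bsub>P\<^esub>" "x \<ominus>\<^bsub>P\<^esub> x = \<zero>\<^bsub>P\<^esub>"
      if "x \<in> carrier P" "y \<in> carrier P" for x y
      using that by (simp_all add: a_minus_def P.r_neg P.minus_add P.a_ac P.a_lcomm[of y "\<ominus>\<^bsub>P\<^esub> x"])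
    have Bl: "B (v \<oplus>\<^bsub>V\<^esub> v') w = B v w \<oplus>\<^bsub>P\<^esub> B v' w" "B (c \<odot>\<^bsub>V\<^esub> v) w = c \<odot>\<^bsub>P\<^esub> B v w"
      if "v \<in> carrier V" "w \<in> carrier W" "v' \<in> carrier V" for v v' w c
      using B that by (auto simp: bilin_maps_def lin_maps_def)
    have Br: "B v (w \<oplus>\<^bsub>W\<^esub> w') = B v w \<oplus>\<^bsub>P\<^esub> B v w'" "B v (c \<odot>\<^bsub>W\<^esub> w) = c \<odot>\<^bsub>P\<^esub> B v w"
      if "v \<in> carrier V" "w \<in> carrier W" "w' \<in> carrier W" for v w w' c
      using B that by (auto simp: bilin_maps_def lin_maps_def)
    have Vc: "c \<odot>\<^bsub>V\<^esub> v \<in> carrier V" if "v \<in> carrier V" for c v using V.smult_closed that by simp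
    have Wc: "c \<odot>\<^bsub>W\<^esub> w \<in> carrier W" if "w \<in> carrier W" for c w using W.smult_closed that by simp
    have Pc: "c \<odot>\<^bsub>P\<^esub> x \<in> carrier P" if "x \<in> carrier P" for c x using P.smult_closed that by simp
    show ?thesis
      unfolding tensor_rels_def
      by (auto simp: diff s Fscale ev Bl(1) Br(1) Bl(2)[OF _ _ V.zero_closed] Br(2)[OF _ _ W.zero_closed] Bc 0(1) 0(2)[OF _ P.zero_closed] Vc Wc Pc)
  qed
  ultimately show ?thesis
    using f by (auto simp: tensor_null_def lin_span_def)
qed

lemma tensor_lift_eq:
  assumes P: "module complex_ring P" and V: "module complex_ring V" and W: "module complex_ring W"
    and B: "B \<in> bilin_maps V W P" and t: "t \<in> carrier (tensor V W)" and f: "f \<in> t"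
  shows "tensor_lift P B t = free_eval P B f"
proof -
  interpret P: module complex_ring P by (rule P)
  let ?F = "free_space (carrier V \<times> carrier W)"
  have Bc: "B v w \<in> carrier P" if "v \<in> carrier V" "w \<in> carrier W" for v w
    using B that by (auto simp: bilin_maps_def lin_maps_def)
  obtain g where g: "g \<in> carrier ?F" and t_eq: "t = tensor_null V W +>\<^bsub>?F\<^esub> g"
    using t by (auto simp: tensor_def quotient_space_def A_RCOSETS_def')
  have "free_eval P B e = free_eval P B g" if e: "e \<in> t" for e
  proof -
    obtain n where n: "n \<in> tensor_null V W" and "e = n \<oplus>\<^bsub>?F\<^esub> g"
      using e by (auto simp: t_eq a_r_coset_defs)
    then have "e = (\<lambda>p. n p + g p)" by (simp add: free_space_def)
    with tensor_null_eval[OF P V W B n] free_eval_add[of P V W B n g, OF P Bc _ g]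
      free_eval_closed[of P V W B g, OF P Bc g] show ?thesis by simp
  qed
  then show ?thesis
    unfolding tensor_lift_def using f by (metis someI)
qed

lemma lin_span_submodule:
  assumes "module complex_ring V" "S \<subseteq> carrier V"
  shows "submodule (lin_span V S) complex_ring V"
proof -
  interpret V: module complex_ring V by fact
  show ?thesis
    unfolding lin_span_def
  proof (intro V.submoduleI)
    show "\<Inter>{U. submodule U complex_ring V \<and> S \<subseteq> U} \<subseteq> carrier V"
      using V.carrier_is_submodule assms(2) by blast
    show "\<zero>\<^bsub>V\<^esub> \<in> \<Inter>{U. submodule U complex_ring V \<and> S \<subseteq> U}"
      by (auto dest!: submodule.axioms(1) dest: subgroup.one_closed)
  qed (blast intro: V.submoduleE(3) V.submoduleE(4) V.submoduleE(5))+
qed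

lemma quotient_module:
  assumes V: "module complex_ring V" and N: "submodule N complex_ring V"
  shows "module complex_ring (quotient_space V N)"
    and "(\<lambda>x. N +>\<^bsub>V\<^esub> x) \<in> lin_maps V (quotient_space V N)"
    and "x \<in> carrier V \<Longrightarrow> x \<in> N +>\<^bsub>V\<^esub> x"
    and "n \<in> N \<Longrightarrow> N +>\<^bsub>V\<^esub> n = N"
proof -
  interpret V: module complex_ring V by (rule V)
  let ?Q = "quotient_space V N"
  interpret N: abelian_subgroup N V
    using N V.abelian_group_axioms
    by (intro abelian_subgroupI3 additive_subgroup.intro submodule.axioms(1)) auto
  have Nc: "x \<in> N \<Longrightarrow> x \<in> carrier V" "x \<in> N \<Longrightarrow> c \<odot>\<^bsub>V\<^esub> x \<in> N" for x c
    using V.submoduleE[OF N] by auto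
  have Vc: "c \<odot>\<^bsub>V\<^esub> x \<in> carrier V" if "x \<in> carrier V" for c x using that V.smult_closed by simp
  show self: "x \<in> carrier V \<Longrightarrow> x \<in> N +>\<^bsub>V\<^esub> x" for x by (rule N.a_rcos_self)
  show "n \<in> N \<Longrightarrow> N +>\<^bsub>V\<^esub> n = N" by (rule N.a_rcos_const)
  have sm: "c \<odot>\<^bsub>?Q\<^esub> (N +>\<^bsub>V\<^esub> x) = N +>\<^bsub>V\<^esub> (c \<odot>\<^bsub>V\<^esub> x)" if x: "x \<in> carrier V" for c x
  proof -
    have "N +>\<^bsub>V\<^esub> (c \<odot>\<^bsub>V\<^esub> y) = N +>\<^bsub>V\<^esub> (c \<odot>\<^bsub>V\<^esub> x)" if y: "y \<in> N +>\<^bsub>V\<^esub> x" for y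
    proof -
      obtain n where n: "n \<in> N" "y = n \<oplus>\<^bsub>V\<^esub> x" using y by (auto simp: a_r_coset_defs)
      then have "c \<odot>\<^bsub>V\<^esub> y = (c \<odot>\<^bsub>V\<^esub> n) \<oplus>\<^bsub>V\<^esub> (c \<odot>\<^bsub>V\<^esub> x)"
        using V.smult_r_distr x Nc by simp
      then have "c \<odot>\<^bsub>V\<^esub> y \<in> N +>\<^bsub>V\<^esub> (c \<odot>\<^bsub>V\<^esub> x)"
        using Nc(2)[OF n(1)] by (auto simp: a_r_coset_defs)
      from N.a_repr_independence'[OF this Vc[OF x]] show ?thesis by (rule sym)
    qed
    then have "(\<Union>y\<in>N +>\<^bsub>V\<^esub> x. N +>\<^bsub>V\<^esub> (c \<odot>\<^bsub>V\<^esub> y)) = N +>\<^bsub>V\<^esub> (c \<odot>\<^bsub>V\<^esub> x)"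
      using self[OF x] by blast
    then show ?thesis by (simp add: quotient_space_def)
  qed
  have car: "carrier ?Q = (\<lambda>x. N +>\<^bsub>V\<^esub> x) ` carrier V"
    by (auto simp: quotient_space_def A_RCOSETS_def')
  have add: "(N +>\<^bsub>V\<^esub> x) \<oplus>\<^bsub>?Q\<^esub> (N +>\<^bsub>V\<^esub> y) = N +>\<^bsub>V\<^esub> (x \<oplus>\<^bsub>V\<^esub> y)" if "x \<in> carrier V" "y \<in> carrier V" for x y
    using N.a_rcos_sum[OF that] by (simp add: quotient_space_def)
  have zero: "\<zero>\<^bsub>?Q\<^esub> = N +>\<^bsub>V\<^esub> \<zero>\<^bsub>V\<^esub>"
    using N.a_rcos_const[OF N.zero_closed] by (simp add: quotient_space_def)
  show "(\<lambda>x. N +>\<^bsub>V\<^esub> x) \<in> lin_maps V ?Q"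
    by (auto simp: lin_maps_def car sm add)
  show "module complex_ring ?Q"
  proof (rule moduleI)
    show "abelian_group ?Q"
    proof (rule abelian_groupI)
      fix A assume "A \<in> carrier ?Q"
      then obtain x where x: "x \<in> carrier V" "A = N +>\<^bsub>V\<^esub> x" by (auto simp: car)
      then show "\<exists>B\<in>carrier ?Q. B \<oplus>\<^bsub>?Q\<^esub> A = \<zero>\<^bsub>?Q\<^esub>"
        by (intro bexI[of _ "N +>\<^bsub>V\<^esub> (\<ominus>\<^bsub>V\<^esub> x)"]) (auto simp: car add zero V.l_neg)
    qed (auto simp: car add zero V.a_ac)
    show "cring complex_ring" by (rule cring_from_type_algebra)
  next
    fix a b A assume "A \<in> carrier ?Q"
    then show "(a \<oplus>\<^bsub>complex_ring\<^esub> b) \<odot>\<^bsub>?Q\<^esub> A = a \<odot>\<^bsub>?Q\<^esub> A \<oplus>\<^bsub>?Q\<^esub> b \<odot>\<^bsub>?Q\<^esub> A"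
      using V.smult_l_distr by (auto simp: car sm add Vc)
    show "(a \<otimes>\<^bsub>complex_ring\<^esub> b) \<odot>\<^bsub>?Q\<^esub> A = a \<odot>\<^bsub>?Q\<^esub> (b \<odot>\<^bsub>?Q\<^esub> A)"
      using V.smult_assoc1 \<open>A \<in> _\<close> by (auto simp: car sm add Vc)
  next
    fix A show "A \<in> carrier ?Q \<Longrightarrow> \<one>\<^bsub>complex_ring\<^esub> \<odot>\<^bsub>?Q\<^esub> A = A"
      using V.smult_one by (auto simp: car sm)
  qed (use V.smult_r_distr in \<open>auto simp: car sm add Vc\<close>)
qed

lemma tensor_rels_subset:
  assumes V: "module complex_ring V" and W: "module complex_ring W"
  shows "tensor_rels V W \<subseteq> carrier (free_space (carrier V \<times> carrier W))"
proof -
  let ?F = "free_space (carrier V \<times> carrier W)"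
  interpret V: module complex_ring V by (rule V)
  interpret W: module complex_ring W by (rule W)
  have s: "single (v, w) \<in> carrier ?F" if "v \<in> carrier V" "w \<in> carrier W" for v w
    using that by (auto intro: single_in_free_space)
  have Vc: "c \<odot>\<^bsub>V\<^esub> v \<in> carrier V" if "v \<in> carrier V" for c v using V.smult_closed that by simp
  have Wc: "c \<odot>\<^bsub>W\<^esub> w \<in> carrier W" if "w \<in> carrier W" for c w using W.smult_closed that by simp
  have diff: "(\<lambda>p. f p - c * g p) \<in> carrier ?F" if "f \<in> carrier ?F" "g \<in> carrier ?F" for f g c
  proof -
    have "finite {p. f p - c * g p \<noteq> 0}"
      by (rule finite_subset[of _ "{p. f p \<noteq> 0} \<union> {p. g p \<noteq> 0}"]) (use that in \<open>auto simp: free_space_def\<close>)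
    moreover have "f p = 0 \<and> g p = 0" if "p \<notin> carrier V \<times> carrier W" for p
      using that \<open>f \<in> _\<close> \<open>g \<in> _\<close> by (auto simp: free_space_def)
    ultimately show ?thesis by (auto simp: free_space_def) (metis diff_zero mult_zero_right mem_Sigma_iff)+
  qed
  show ?thesis unfolding tensor_rels_def
    using diff[of _ _ 1] by (auto simp: s Vc Wc diff)
qed

lemma
  assumes V: "module complex_ring V" and W: "module complex_ring W"
  shows tensor_module: "module complex_ring (tensor V W)"
    and pure_bilin: "pure V W \<in> bilin_maps V W (tensor V W)"
    and pure_rep: "\<lbrakk>v \<in> carrier V; w \<in> carrier W\<rbrakk> \<Longrightarrow> single (v, w) \<in> pure V W v w"
proof -
  let ?F = "free_space (carrier V \<times> carrier W)"
  interpret F: module complex_ring ?F by (rule free_space_module)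
  interpret V: module complex_ring V by (rule V)
  interpret W: module complex_ring W by (rule W)
  have sub: "submodule (tensor_null V W) complex_ring ?F"
    unfolding tensor_null_def by (intro lin_span_submodule free_space_module tensor_rels_subset V W)
  note q = quotient_module[OF free_space_module sub]
  show t: "module complex_ring (tensor V W)" unfolding tensor_def by (rule q)
  interpret T: module complex_ring "tensor V W" by (rule t)
  let ?q = "\<lambda>x. tensor_null V W +>\<^bsub>?F\<^esub> x"
  have q2: "?q \<in> lin_maps ?F (tensor V W)" unfolding tensor_def by (rule q)
  have s: "single (v, w) \<in> carrier ?F" if "v \<in> carrier V" "w \<in> carrier W" for v w
    using that by (auto intro: single_in_free_space)
  show "\<lbrakk>v \<in> carrier V; w \<in> carrier W\<rbrakk> \<Longrightarrow> single (v, w) \<in> pure V W v w"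
    unfolding pure_def by (intro q(3) s)
  have r: "r \<in> tensor_rels V W \<Longrightarrow> ?q r = \<zero>\<^bsub>tensor V W\<^esub>" for r
    using q(4)[of r] by (auto simp: tensor_null_def lin_span_def tensor_def quotient_space_def)
  have eq: "?q f = ?q g" if "f \<in> carrier ?F" "g \<in> carrier ?F" "(\<lambda>p. f p - g p) \<in> tensor_rels V W" for f g
  proof -
    have "(\<lambda>p. f p - g p) \<in> carrier ?F" using that tensor_rels_subset[OF V W] by auto
    then have "?q ((\<lambda>p. f p - g p) \<oplus>\<^bsub>?F\<^esub> g) = ?q (\<lambda>p. f p - g p) \<oplus>\<^bsub>tensor V W\<^esub> ?q g"
      using q2 that by (auto simp: lin_maps_def)
    also have "(\<lambda>p. f p - g p) \<oplus>\<^bsub>?F\<^esub> g = f" by (simp add: free_space_def)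
    finally show ?thesis using r[OF that(3)] q2 that by (auto simp: lin_maps_def Pi_iff)
  qed
  have a: "?q (f \<oplus>\<^bsub>?F\<^esub> g) = ?q f \<oplus>\<^bsub>tensor V W\<^esub> ?q g" "?q (c \<odot>\<^bsub>?F\<^esub> f) = c \<odot>\<^bsub>tensor V W\<^esub> ?q f"
     "f \<oplus>\<^bsub>?F\<^esub> g \<in> carrier ?F" "c \<odot>\<^bsub>?F\<^esub> f \<in> carrier ?F" "?q f \<in> carrier (tensor V W)"
    if "f \<in> carrier ?F" "g \<in> carrier ?F" for f g c
    using q2 that F.smult_closed[of c f] by (auto simp: lin_maps_def)
  have Vc: "c \<odot>\<^bsub>V\<^esub> v \<in> carrier V" if "v \<in> carrier V" for c v using V.smult_closed that by simp
  have Wc: "c \<odot>\<^bsub>W\<^esub> w \<in> carrier W" if "w \<in> carrier W" for c w using W.smult_closed that by simp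
  have l1: "pure V W (v \<oplus>\<^bsub>V\<^esub> v') w = pure V W v w \<oplus>\<^bsub>tensor V W\<^esub> pure V W v' w"
    if "v \<in> carrier V" "v' \<in> carrier V" "w \<in> carrier W" for v v' w
    unfolding pure_def a(1)[OF s s, OF that(1,3,2,3), symmetric]
    by (rule eq) (use that in \<open>auto simp: s a, auto simp: tensor_rels_def free_space_def fun_eq_iff diff_diff_eq\<close>)
  have l2: "pure V W v (w \<oplus>\<^bsub>W\<^esub> w') = pure V W v w \<oplus>\<^bsub>tensor V W\<^esub> pure V W v w'"
    if "v \<in> carrier V" "w' \<in> carrier W" "w \<in> carrier W" for v w' w
    unfolding pure_def a(1)[OF s s, OF that(1,3,1,2), symmetric]
    by (rule eq) (use that in \<open>auto simp: s a, auto simp: tensor_rels_def free_space_def fun_eq_iff diff_diff_eq\<close>)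
  have l3: "pure V W (c \<odot>\<^bsub>V\<^esub> v) w = c \<odot>\<^bsub>tensor V W\<^esub> pure V W v w"
    if "v \<in> carrier V" "w \<in> carrier W" for v w c
    unfolding pure_def a(2)[OF s s, OF that that, symmetric]
    by (rule eq) (use that in \<open>auto simp: s a Vc Wc, auto simp: tensor_rels_def free_space_def fun_eq_iff\<close>)
  have l4: "pure V W v (c \<odot>\<^bsub>W\<^esub> w) = c \<odot>\<^bsub>tensor V W\<^esub> pure V W v w"
    if "v \<in> carrier V" "w \<in> carrier W" for v w c
    unfolding pure_def a(2)[OF s s, OF that that, symmetric]
    by (rule eq) (use that in \<open>auto simp: s a Vc Wc, auto simp: tensor_rels_def free_space_def fun_eq_iff\<close>)
  have "pure V W v w \<in> carrier (tensor V W)" if "v \<in> carrier V" "w \<in> carrier W" for v w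
    unfolding pure_def by (rule a(5)[OF s s, OF that that])
  then show "pure V W \<in> bilin_maps V W (tensor V W)"
    by (simp add: bilin_maps_def lin_maps_def l1 l2 l3 l4 Pi_iff)
qed

lemma tensor_lift_pure:
  assumes P: "module complex_ring P" and V: "module complex_ring V" and W: "module complex_ring W"
    and B: "B \<in> bilin_maps V W P" and "v \<in> carrier V" "w \<in> carrier W"
  shows "tensor_lift P B (pure V W v w) = B v w"
proof -
  have Bc: "B v w \<in> carrier P" if "v \<in> carrier V" "w \<in> carrier W" for v w
    using B that by (auto simp: bilin_maps_def lin_maps_def)
  have "pure V W v w \<in> carrier (tensor V W)"
    using pure_bilin[OF V W] assms(5,6) by (auto simp: bilin_maps_def lin_maps_def)
  from tensor_lift_eq[OF P V W B this pure_rep[OF V W assms(5,6)]]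
  show ?thesis using free_eval_single[of P V W B, OF P Bc assms(5,6)] by simp
qed

definition tensor_map ::
  "(complex, 'v, 'x) module_scheme \<Rightarrow> (complex, 'w, 'y) module_scheme \<Rightarrow>
   ('u \<Rightarrow> 'v) \<Rightarrow> ('t \<Rightarrow> 'w) \<Rightarrow> ('u \<times> 't \<Rightarrow> complex) set \<Rightarrow> ('v \<times> 'w \<Rightarrow> complex) set" where
  "tensor_map V W f g = tensor_lift (tensor V W) (\<lambda>x y. pure V W (f x) (g y))"

definition tensor_assoc ::
  "(complex, 'u, 'x) module_scheme \<Rightarrow> (complex, 'v, 'y) module_scheme \<Rightarrow>
   (complex, 'w, 'z) module_scheme \<Rightarrow>
   (('u \<times> 'v \<Rightarrow> complex) set \<times> 'w \<Rightarrow> complex) set \<Rightarrow>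
   ('u \<times> ('v \<times> 'w \<Rightarrow> complex) set \<Rightarrow> complex) set" where
  "tensor_assoc U V W =
     tensor_lift (tensor U (tensor V W))
       (\<lambda>t w. tensor_lift (tensor U (tensor V W)) (\<lambda>u v. pure U (tensor V W) u (pure V W v w)) t)"

definition tensor_algebra ::
  "(complex, 'a, 'x) module_scheme \<Rightarrow> (complex, 'b, 'y) module_scheme \<Rightarrow>
   (complex, ('a \<times> 'b \<Rightarrow> complex) set) module" where
  "tensor_algebra A B = (tensor A B)
     \<lparr>monoid.mult := (\<lambda>s t. tensor_lift (tensor A B)
        (\<lambda>a b. tensor_lift (tensor A B) (\<lambda>a' b'. pure A B (a \<otimes>\<^bsub>A\<^esub> a') (b \<otimes>\<^bsub>B\<^esub> b')) t) s),
      one := pure A B \<one>\<^bsub>A\<^esub> \<one>\<^bsub>B\<^esub>\<rparr>"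

section \<open>Hopf algebras\<close>

record 'h hopf = "(complex, 'h) module" +
  comult :: "'h \<Rightarrow> ('h \<times> 'h \<Rightarrow> complex) set"
  counit :: "'h \<Rightarrow> complex"
  antipode :: "'h \<Rightarrow> 'h"

text \<open>
  The library's \<open>algebra\<close> locale is restricted to commutative algebras, hence
  \<open>complex_algebra\<close>.
\<close>

locale complex_algebra =
  fixes A :: "(complex, 'a, 'x) module_scheme" (structure)
  assumes is_ring: "ring A"
    and is_module: "module complex_ring A"
    and mult_bilin: "(\<otimes>) \<in> bilin_maps A A A"

locale hopf_algebra = complex_algebra H
  for H :: "('h, 'x) hopf_scheme" (structure) +
  assumes comult_lin: "comult H \<in> lin_maps H (tensor H H)"
    and comult_ring_hom: "comult H \<in> ring_hom H (tensor_algebra H H)"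
    and coassoc: "h \<in> carrier H \<Longrightarrow>
      tensor_assoc H H H (tensor_map (tensor H H) H (comult H) (\<lambda>x. x) (comult H h)) =
      tensor_map H (tensor H H) (\<lambda>x. x) (comult H) (comult H h)"
    and counit_hom: "counit H \<in> ring_hom H complex_ring"
    and counit_smult: "h \<in> carrier H \<Longrightarrow> counit H (c \<odot> h) = c * counit H h"
    and counit_left: "h \<in> carrier H \<Longrightarrow>
      tensor_lift H (\<lambda>a b. counit H a \<odot> b) (comult H h) = h"
    and counit_right: "h \<in> carrier H \<Longrightarrow>
      tensor_lift H (\<lambda>a b. counit H b \<odot> a) (comult H h) = h"
    and antipode_lin: "antipode H \<in> lin_maps H H"
    and antipode_left: "h \<in> carrier H \<Longrightarrow>
      tensor_lift H (\<lambda>a b. antipode H a \<otimes> b) (comult H h) = counit H h \<odot> \<one>"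
    and antipode_right: "h \<in> carrier H \<Longrightarrow>
      tensor_lift H (\<lambda>a b. a \<otimes> antipode H b) (comult H h) = counit H h \<odot> \<one>"
    and antipode_bij: "bij_betw (antipode H) (carrier H) (carrier H)"

section \<open>Categories with an action\<close>

text \<open>
  \<open>Comp D x y z g f\<close> is the composite \<open>gf\<close> of \<open>f : x \<rightarrow> y\<close> and \<open>g : y \<rightarrow> z\<close>. Hom-spaces of
  different pairs of objects need not be disjoint, so all operations are indexed by objects.
\<close>

record ('o, 'm) lin_cat =
  Ob :: "'o set"
  Hom :: "'o \<Rightarrow> 'o \<Rightarrow> (complex, 'm) module"
  Comp :: "'o \<Rightarrow> 'o \<Rightarrow> 'o \<Rightarrow> 'm \<Rightarrow> 'm \<Rightarrow> 'm"
  Ident :: "'o \<Rightarrow> 'm"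

record ('o, 'm, 'h) act_cat = "('o, 'm) lin_cat" +
  Act :: "'o \<Rightarrow> 'o \<Rightarrow> 'h \<Rightarrow> 'm \<Rightarrow> 'm"

locale linear_category =
  fixes D :: "('o, 'm, 'x) lin_cat_scheme"
  assumes hom_module: "\<lbrakk>x \<in> Ob D; y \<in> Ob D\<rbrakk> \<Longrightarrow> module complex_ring (Hom D x y)"
    and comp_bilin: "\<lbrakk>x \<in> Ob D; y \<in> Ob D; z \<in> Ob D\<rbrakk> \<Longrightarrow>
      Comp D x y z \<in> bilin_maps (Hom D y z) (Hom D x y) (Hom D x z)"
    and ident_closed: "x \<in> Ob D \<Longrightarrow> Ident D x \<in> carrier (Hom D x x)"
    and comp_assoc: "\<lbrakk>w \<in> Ob D; x \<in> Ob D; y \<in> Ob D; z \<in> Ob D;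
        f \<in> carrier (Hom D w x); g \<in> carrier (Hom D x y); e \<in> carrier (Hom D y z)\<rbrakk> \<Longrightarrow>
      Comp D w x z (Comp D x y z e g) f = Comp D w y z e (Comp D w x y g f)"
    and ident_left: "\<lbrakk>x \<in> Ob D; y \<in> Ob D; f \<in> carrier (Hom D x y)\<rbrakk> \<Longrightarrow>
      Comp D x y y (Ident D y) f = f"
    and ident_right: "\<lbrakk>x \<in> Ob D; y \<in> Ob D; f \<in> carrier (Hom D x y)\<rbrakk> \<Longrightarrow>
      Comp D x x y f (Ident D x) = f"

text \<open>
  Bilinearity of the action says in particular that the scalars of \<open>Hom D x y\<close> are those that
  the \<open>H\<close>-module structure induces.
\<close>

locale left_module_over =
  fixes H :: "(complex, 'h, 'x) module_scheme" (structure)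
    and M :: "(complex, 'm, 'y) module_scheme"
    and act :: "'h \<Rightarrow> 'm \<Rightarrow> 'm"
  assumes space: "module complex_ring M"
    and act_bilin: "act \<in> bilin_maps H M M"
    and act_mult: "\<lbrakk>h \<in> carrier H; k \<in> carrier H; m \<in> carrier M\<rbrakk> \<Longrightarrow>
      act (h \<otimes> k) m = act h (act k m)"
    and act_one: "m \<in> carrier M \<Longrightarrow> act \<one> m = m"

locale left_H_category = linear_category D
  for H :: "('h, 'x) hopf_scheme" and D :: "('o, 'm, 'h, 'y) act_cat_scheme" +
  assumes act_module: "\<lbrakk>x \<in> Ob D; y \<in> Ob D\<rbrakk> \<Longrightarrow>
      left_module_over H (Hom D x y) (Act D x y)"
    and act_ident: "\<lbrakk>x \<in> Ob D; h \<in> carrier H\<rbrakk> \<Longrightarrow>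
      Act D x x h (Ident D x) = counit H h \<odot>\<^bsub>Hom D x x\<^esub> Ident D x"
    and act_comp: "\<lbrakk>x \<in> Ob D; y \<in> Ob D; z \<in> Ob D; h \<in> carrier H;
        f \<in> carrier (Hom D x y); g \<in> carrier (Hom D y z)\<rbrakk> \<Longrightarrow>
      Act D x z h (Comp D x y z g f) =
      tensor_lift (Hom D x z) (\<lambda>a b. Comp D x y z (Act D y z a g) (Act D x y b f)) (comult H h)"

definition End_monoid :: "('o, 'm, 'x) lin_cat_scheme \<Rightarrow> 'o \<Rightarrow> 'm monoid" where
  "End_monoid D x =
     \<lparr>carrier = carrier (Hom D x x), monoid.mult = Comp D x x x, one = Ident D x\<rparr>"

definition Aut_group :: "('o, 'm, 'x) lin_cat_scheme \<Rightarrow> 'o \<Rightarrow> 'm monoid" where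
  "Aut_group D x = units_of (End_monoid D x)"

text \<open>
  \<open>product_group\<close> consists of extensional families, so an element of \<open>GG D\<close> is determined by
  its values on the objects of \<open>D\<close>. The product in \<open>GG D\<close> is componentwise composition.
\<close>

definition GG :: "('o, 'm, 'x) lin_cat_scheme \<Rightarrow> ('o \<Rightarrow> 'm) monoid" where
  "GG D = product_group (Ob D) (Aut_group D)"

lemma (in linear_category) group_GG: "group (GG D)"
proof -
  have "monoid (End_monoid D x)" if "x \<in> Ob D" for x
    using that comp_bilin[of x x x]
    by (intro monoidI)
       (auto simp: End_monoid_def bilin_maps_def lin_maps_def ident_closed comp_assoc ident_left ident_right)
  then show ?thesis
    by (simp add: GG_def Aut_group_def monoid.units_group)
qed

definition UU :: "('h, 'x) hopf_scheme \<Rightarrow> ('o, 'm, 'h, 'y) act_cat_scheme \<Rightarrow> ('o \<Rightarrow> 'm) set" where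
  "UU H D = {\<eta> \<in> carrier (GG D). \<forall>h\<in>carrier H. \<forall>x\<in>Ob D.
     Act D x x h (\<eta> x) = counit H h \<odot>\<^bsub>Hom D x x\<^esub> \<eta> x}"

end

theory Submission
  imports Defs
begin

text \<open>
  If \<open>g\<close> is invariant, the counit axiom gives
  \<open>h(gf) = (h\<^sub>1 g)(h\<^sub>2 f) = g (\<epsilon>(h\<^sub>1) h\<^sub>2 f) = g (h f)\<close>, so that acting commutes with
  composing with \<open>g\<close> on the left. Closure under products is immediate, and applying this to
  \<open>\<epsilon>(h) id = h(g g\<inverse>)\<close> and cancelling \<open>g\<close> shows that \<open>g\<inverse>\<close> is invariant.
\<close>

text \<open>\<open>tensor_lift\<close> evaluates at a chosen element of a class. The choice is
  usable because the coset of a carrier element is nonempty and stays inside the carrier: the chosen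
  element is a finitely supported combination of pairs.\<close>

lemma some_tensor_rep:
  assumes V: "module complex_ring V" and W: "module complex_ring W"
    and t: "t \<in> carrier (tensor V W)"
  shows "(SOME f. f \<in> t) \<in> carrier (free_space (carrier V \<times> carrier W))"
proof -
  let ?F = "free_space (carrier V \<times> carrier W)"
  interpret F: module complex_ring ?F by (rule free_space_module)
  have sub: "submodule (tensor_null V W) complex_ring ?F"
    unfolding tensor_null_def by (intro lin_span_submodule free_space_module tensor_rels_subset V W)
  obtain g where g: "g \<in> carrier ?F" and t_eq: "t = tensor_null V W +>\<^bsub>?F\<^esub> g"
    using t by (auto simp: tensor_def quotient_space_def A_RCOSETS_def')
  have "g \<in> t"
    unfolding t_eq by (rule quotient_module(3)[OF free_space_module sub g])
  moreover have "t \<subseteq> carrier ?F"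
    unfolding t_eq using F.submoduleE(1)[OF sub] g by (rule F.a_r_coset_subset_G)
  ultimately show ?thesis by (metis someI subsetD)
qed

text \<open>A linear map passes through a finite sum of scaled terms. This is the tool for pulling
  \<open>L\<close> out of a Sweedler sum: both sides are evaluated at the same representative
  \<open>f\<close>, so \<open>C\<close> only has to match \<open>L\<close> after \<open>B\<close>
  term by term on the carriers.\<close>

lemma lin_maps_free_eval:
  fixes V :: "(complex, 'v, 'x) module_scheme" and W :: "(complex, 'w, 'y) module_scheme"
  assumes P: "module complex_ring P" and Q: "module complex_ring Q"
    and L: "L \<in> lin_maps P Q"
    and B: "\<And>v w. v \<in> carrier V \<Longrightarrow> w \<in> carrier W \<Longrightarrow> B v w \<in> carrier P"
    and C: "\<And>v w. v \<in> carrier V \<Longrightarrow> w \<in> carrier W \<Longrightarrow> C v w = L (B v w)"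
    and f: "f \<in> carrier (free_space (carrier V \<times> carrier W))"
  shows "L (free_eval P B f) = free_eval Q C f"
proof -
  interpret P: module complex_ring P by (rule P)
  interpret Q: module complex_ring Q by (rule Q)
  interpret L: abelian_group_hom P Q L
    using L by (intro abelian_group_homI group_hom.intro group_hom_axioms.intro
        P.a_group Q.a_group P.abelian_group_axioms Q.abelian_group_axioms)
      (auto simp: lin_maps_def hom_def)
  \<comment> \<open>An infinite \<open>A\<close> is covered too: both sums are then zero by
    convention, and \<open>L\<close> preserves zero.\<close>
  have finsum: "L (finsum P g A) = (\<Oplus>\<^bsub>Q\<^esub>a\<in>A. L (g a))" if "g \<in> A \<rightarrow> carrier P"
    for g and A :: "('v \<times> 'w) set"
    using that by (induction A rule: infinite_finite_induct) (auto simp: Pi_iff)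
  have S: "{p. f p \<noteq> 0} \<subseteq> carrier V \<times> carrier W"
    using f by (simp add: free_space_def)
  have Pc: "c \<odot>\<^bsub>P\<^esub> x \<in> carrier P" and Lc: "L (c \<odot>\<^bsub>P\<^esub> x) = c \<odot>\<^bsub>Q\<^esub> L x"
    if "x \<in> carrier P" for c x
    using L P.smult_closed that by (auto simp: lin_maps_def)
  have "L (free_eval P B f) = (\<Oplus>\<^bsub>Q\<^esub>p\<in>{p. f p \<noteq> 0}. L (f p \<odot>\<^bsub>P\<^esub> B (fst p) (snd p)))"
    unfolding free_eval_def using S B Pc by (intro finsum) auto
  also have "\<dots> = free_eval Q C f"
    unfolding free_eval_def using S B C Pc Lc
    by (intro Q.finsum_cong') (auto simp flip: Lc)
  finally show ?thesis .
qed

context linear_category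
begin

lemma comp_smult_left:
  "\<lbrakk>x \<in> Ob D; y \<in> Ob D; z \<in> Ob D; f \<in> carrier (Hom D x y); g \<in> carrier (Hom D y z)\<rbrakk> \<Longrightarrow>
    Comp D x y z (c \<odot>\<^bsub>Hom D y z\<^esub> g) f = c \<odot>\<^bsub>Hom D x z\<^esub> Comp D x y z g f"
  using comp_bilin[of x y z] by (auto simp: bilin_maps_def lin_maps_def)

lemma comp_lin_right:
  "\<lbrakk>x \<in> Ob D; y \<in> Ob D; z \<in> Ob D; g \<in> carrier (Hom D y z)\<rbrakk> \<Longrightarrow>
    Comp D x y z g \<in> lin_maps (Hom D x y) (Hom D x z)"
  using comp_bilin[of x y z] by (auto simp: bilin_maps_def)

lemma comp_smult_right:
  "\<lbrakk>x \<in> Ob D; y \<in> Ob D; z \<in> Ob D; f \<in> carrier (Hom D x y); g \<in> carrier (Hom D y z)\<rbrakk> \<Longrightarrow>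
    Comp D x y z g (c \<odot>\<^bsub>Hom D x y\<^esub> f) = c \<odot>\<^bsub>Hom D x z\<^esub> Comp D x y z g f"
  using comp_lin_right[of x y z g] by (auto simp: lin_maps_def)

lemma monoid_End: "x \<in> Ob D \<Longrightarrow> monoid (End_monoid D x)"
  using comp_bilin[of x x x]
  by (intro monoidI)
    (auto simp: End_monoid_def bilin_maps_def lin_maps_def ident_closed comp_assoc ident_left ident_right)

lemma group_Aut: "x \<in> Ob D \<Longrightarrow> group (Aut_group D x)"
  by (simp add: Aut_group_def monoid.units_group monoid_End)

lemma Aut_group_closed: "f \<in> carrier (Aut_group D x) \<Longrightarrow> f \<in> carrier (Hom D x x)"
  by (simp add: Aut_group_def units_of_def Units_def End_monoid_def)

lemma Aut_group_simps [simp]: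
  "g \<otimes>\<^bsub>Aut_group D x\<^esub> f = Comp D x x x g f" "\<one>\<^bsub>Aut_group D x\<^esub> = Ident D x"
  by (simp_all add: Aut_group_def units_of_def End_monoid_def)

end

text \<open>The subspace of a Hom-space on which \<open>H\<close> acts through its counit. The
  endpoints may differ, although \<open>UU\<close> only involves endomorphisms; the closure lemmas
  below are thus about arbitrary composable morphisms.\<close>

definition invariant :: "('h, 'x) hopf_scheme \<Rightarrow> ('o, 'm, 'h, 'y) act_cat_scheme \<Rightarrow>
  'o \<Rightarrow> 'o \<Rightarrow> 'm \<Rightarrow> bool" where
  "invariant H D x y f \<longleftrightarrow> (\<forall>h\<in>carrier H. Act D x y h f = counit H h \<odot>\<^bsub>Hom D x y\<^esub> f)"

context left_H_category
begin

lemma act_lin: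
  assumes "x \<in> Ob D" "y \<in> Ob D" "f \<in> carrier (Hom D x y)"
  shows "(\<lambda>h. Act D x y h f) \<in> lin_maps H (Hom D x y)"
  using left_module_over.act_bilin[OF act_module[of x y]] assms by (auto simp: bilin_maps_def)

lemma act_closed:
  "\<lbrakk>x \<in> Ob D; y \<in> Ob D; f \<in> carrier (Hom D x y); h \<in> carrier H\<rbrakk> \<Longrightarrow> Act D x y h f \<in> carrier (Hom D x y)"
  using act_lin[of x y f] by (auto simp: lin_maps_def)

lemma act_comp_invariant:
  assumes "hopf_algebra H"
    and obj: "x \<in> Ob D" "y \<in> Ob D" "z \<in> Ob D"
    and f: "f \<in> carrier (Hom D x y)" and g: "g \<in> carrier (Hom D y z)"
    and inv: "invariant H D y z g" and h: "h \<in> carrier H"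
  shows "Act D x z h (Comp D x y z g f) = Comp D x y z g (Act D x y h f)"
proof -
  interpret H: hopf_algebra H by fact
  interpret HM: module complex_ring H by (rule H.is_module)
  \<comment> \<open>The same choice of representative as in \<open>tensor_lift\<close>, so that the
    Sweedler sums of \<open>act_comp\<close> and \<open>counit_left\<close> both become sums over
    \<open>r\<close>.\<close>
  define r where "r = (SOME r. r \<in> comult H h)"
  let ?L = "\<lambda>b. Comp D x y z g (Act D x y b f)"
  have "comult H h \<in> carrier (tensor H H)"
    using H.comult_lin h by (auto simp: lin_maps_def)
  then have r: "r \<in> carrier (free_space (carrier H \<times> carrier H))"
    unfolding r_def by (intro some_tensor_rep H.is_module)
  have Hc: "c \<odot>\<^bsub>H\<^esub> b \<in> carrier H" if "b \<in> carrier H" for b c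
    using HM.smult_closed that by simp
  have L: "?L \<in> lin_maps H (Hom D x z)"
    using comp_lin_right[OF obj g] act_lin[OF obj(1,2) f] by (auto simp: lin_maps_def Pi_iff)
  \<comment> \<open>Termwise,
    \<open>(a g)(b f) = (\<epsilon>(a) g)(b f) = g((\<epsilon>(a) b) f)\<close>: the scalar leaves
    the first factor by bilinearity of composition and enters the algebra element by linearity of
    \<open>?L\<close>.\<close>
  have eq: "Comp D x y z (Act D y z a g) (Act D x y b f) = ?L (counit H a \<odot>\<^bsub>H\<^esub> b)"
    if "a \<in> carrier H" "b \<in> carrier H" for a b
    using L inv that f g obj
    by (simp add: invariant_def lin_maps_def comp_smult_left act_closed)
  have "Act D x z h (Comp D x y z g f) =
      free_eval (Hom D x z) (\<lambda>a b. Comp D x y z (Act D y z a g) (Act D x y b f)) r"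
    using act_comp[OF obj h f g] by (simp add: tensor_lift_def r_def)
  also have "\<dots> = ?L (free_eval H (\<lambda>a b. counit H a \<odot>\<^bsub>H\<^esub> b) r)"
    by (rule lin_maps_free_eval[OF H.is_module hom_module[OF obj(1,3)] L _ eq r, symmetric]) (rule Hc)
  \<comment> \<open>The argument of \<open>?L\<close> is now
    \<open>\<epsilon>(h\<^sub>1) h\<^sub>2\<close>, which the left counit axiom collapses to
    \<open>h\<close>.\<close>
  also have "free_eval H (\<lambda>a b. counit H a \<odot>\<^bsub>H\<^esub> b) r = h"
    using H.counit_left[OF h] by (simp add: tensor_lift_def r_def)
  finally show ?thesis .
qed

lemma invariant_ident: "x \<in> Ob D \<Longrightarrow> invariant H D x x (Ident D x)"
  by (simp add: invariant_def act_ident)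

text \<open>Invariance of \<open>g\<close> moves \<open>h\<close> onto \<open>f\<close>, where it
  acts as the scalar \<open>\<epsilon>(h)\<close>; composition being linear in \<open>f\<close>, the
  scalar comes out.\<close>

lemma invariant_comp:
  assumes "hopf_algebra H"
    and "x \<in> Ob D" "y \<in> Ob D" "z \<in> Ob D"
    and "f \<in> carrier (Hom D x y)" "g \<in> carrier (Hom D y z)"
    and "invariant H D x y f" "invariant H D y z g"
  shows "invariant H D x z (Comp D x y z g f)"
  unfolding invariant_def
proof
  fix h assume "h \<in> carrier H"
  then show "Act D x z h (Comp D x y z g f) = counit H h \<odot>\<^bsub>Hom D x z\<^esub> Comp D x y z g f"
    using act_comp_invariant[OF assms(1-6,8)] assms by (simp add: invariant_def comp_smult_right)
qed

text \<open>Here \<open>g\<close> is the known invariant and \<open>f\<close> its two-sided inverse: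
  \<open>h f = f(g(h f)) = f(h(g f)) = f(\<epsilon>(h) id) = \<epsilon>(h) f\<close>.\<close>

lemma invariant_inverse:
  assumes hopf: "hopf_algebra H"
    and obj: "x \<in> Ob D" "y \<in> Ob D"
    and f: "f \<in> carrier (Hom D x y)" and g: "g \<in> carrier (Hom D y x)"
    and gf: "Comp D x y x g f = Ident D x" and fg: "Comp D y x y f g = Ident D y"
    and inv: "invariant H D y x g"
  shows "invariant H D x y f"
  unfolding invariant_def
proof
  fix h assume h: "h \<in> carrier H"
  note ac = act_closed[OF obj f h]
  have "Act D x y h f = Comp D x y y (Comp D y x y f g) (Act D x y h f)"
    using obj ac by (simp add: fg ident_left)
  also have "\<dots> = Comp D x x y f (Comp D x y x g (Act D x y h f))"
    by (rule comp_assoc) (use obj ac f g in auto)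
  also have "Comp D x y x g (Act D x y h f) = counit H h \<odot>\<^bsub>Hom D x x\<^esub> Ident D x"
    using act_comp_invariant[OF hopf obj obj(1) f g inv h] gf act_ident[OF obj(1) h] by simp
  also have "Comp D x x y f \<dots> = counit H h \<odot>\<^bsub>Hom D x y\<^esub> f"
    using obj f by (simp add: comp_smult_right ident_closed ident_right)
  finally show "Act D x y h f = counit H h \<odot>\<^bsub>Hom D x y\<^esub> f" .
qed

end

theorem lemma5p2:
  fixes H :: "'h hopf"
    and D :: "('o, 'm, 'h) act_cat"
  assumes "hopf_algebra H"
    and "left_H_category H D"
  shows "subgroup (UU H D) (GG D)"
proof -
  interpret left_H_category H D by fact
  \<comment> \<open>Exchanging the two quantifiers turns membership into a condition at each object,
    to which the closure lemmas apply.\<close>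
  have UU: "UU H D = {\<eta> \<in> carrier (GG D). \<forall>x\<in>Ob D. invariant H D x x (\<eta> x)}"
    by (auto simp: UU_def invariant_def)
  have Aut: "\<eta> x \<in> carrier (Aut_group D x)" if "\<eta> \<in> carrier (GG D)" "x \<in> Ob D" for \<eta> x
    using that by (auto simp: GG_def)
  note Hom = Aut_group_closed[OF Aut]
  interpret G: group "GG D" by (rule group_GG)
  show ?thesis
  proof (rule subgroup.intro)
    show "UU H D \<subseteq> carrier (GG D)"
      by (auto simp: UU)
    show "\<one>\<^bsub>GG D\<^esub> \<in> UU H D"
      using G.one_closed by (auto simp: UU GG_def invariant_ident)
  next
    fix \<eta> \<theta> assume "\<eta> \<in> UU H D" "\<theta> \<in> UU H D"
    moreover from this have "\<eta> \<otimes>\<^bsub>GG D\<^esub> \<theta> \<in> carrier (GG D)"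
      by (simp add: UU)
    ultimately show "\<eta> \<otimes>\<^bsub>GG D\<^esub> \<theta> \<in> UU H D"
      using Hom by (auto simp: UU GG_def intro!: invariant_comp[OF assms(1)])
  next
    fix \<eta> assume \<eta>: "\<eta> \<in> UU H D"
    then have \<eta>G: "\<eta> \<in> carrier (GG D)"
      by (simp add: UU)
    have "invariant H D x x ((inv\<^bsub>GG D\<^esub> \<eta>) x)" if x: "x \<in> Ob D" for x
    proof -
      interpret A: group "Aut_group D x" by (rule group_Aut[OF x])
      \<comment> \<open>Inverses in a product of groups are componentwise; this uses that the factor
        at every object is a group.\<close>
      have inv_eq: "(inv\<^bsub>GG D\<^esub> \<eta>) x = inv\<^bsub>Aut_group D x\<^esub> \<eta> x"
        using \<eta>G x group_Aut by (simp add: GG_def)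
      \<comment> \<open>The invariant \<open>g\<close> of \<open>invariant_inverse\<close> is
        \<open>\<eta> x\<close>, and \<open>f\<close> is its inverse in the automorphism
        group.\<close>
      show ?thesis unfolding inv_eq
      proof (rule invariant_inverse[OF assms(1) x x])
        show "inv\<^bsub>Aut_group D x\<^esub> \<eta> x \<in> carrier (Hom D x x)"
          using Aut[OF \<eta>G x] by (intro Aut_group_closed) simp
        show "Comp D x x x (\<eta> x) (inv\<^bsub>Aut_group D x\<^esub> \<eta> x) = Ident D x"
          using A.r_inv[OF Aut[OF \<eta>G x]] by simp
        show "Comp D x x x (inv\<^bsub>Aut_group D x\<^esub> \<eta> x) (\<eta> x) = Ident D x"
          using A.l_inv[OF Aut[OF \<eta>G x]] by simp
      qed (use \<eta> \<eta>G x Hom in \<open>auto simp: UU\<close>)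
    qed
    then show "inv\<^bsub>GG D\<^esub> \<eta> \<in> UU H D"
      using \<eta>G by (simp add: UU)
  qed
qed

end
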